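(* For every clutter $\mathcal{H}$, the number $|b(\mathcal{H})|$ is at most the number of semi-matchings of $\mathcal{H}$.
   Context: A clutter is a finite set of finite subsets of $\mathbb{N}$ that are pairwise incomparable under inclusion. A transversal of $\mathcal{H}$ is a set intersecting every $S\in\mathcal{H}$; the blocker $b(\mathcal{H})$ is the clutter of all inclusion-minimal transversals of $\mathcal{H}$. A semi-matching of a clutter $\mathcal{H}$ is a set of pairs $\mathcal{S} = \{(L_i,S_i)\}_{i=1}^k$ (with $k\ge 0$; the empty set of pairs is allowed if it satisfies the conditions) such that: (1) $|L_i| = 2$, $L_i\subseteq S_i$ and $S_i\in\mathcal{H}$ for each $1\le i\le k$; (2) the sets $L_1,\dots,L_k$ are pairwise disjoint; (3a) $L_i\not\subseteq S_j$ for $i\ne j$; (4) every set $S\in\mathcal{H}$ contained in $\bigcup_i S_i$ contains at least one $L_i$ as a subset. Semi-matchings are counted as (unordered) sets of pairs. *)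

theory Defs imports Main begin

definition clutter :: "nat set set \<Rightarrow> bool" where
  "clutter H \<longleftrightarrow> finite H \<and> (\<forall>S\<in>H. finite S) \<and> (\<forall>S\<in>H. \<forall>T\<in>H. S \<subseteq> T \<longrightarrow> S = T)"

definition transversal :: "nat set set \<Rightarrow> nat set \<Rightarrow> bool" where
  "transversal H T \<longleftrightarrow> (\<forall>S\<in>H. T \<inter> S \<noteq> {})"

definition blocker :: "nat set set \<Rightarrow> nat set set" where
  "blocker H = {T. transversal H T \<and> (\<forall>T'. transversal H T' \<and> T' \<subseteq> T \<longrightarrow> T' = T)}"

(* The family (L_i, S_i), i = 1..k, is given by the set M of its pairs, so distinct indices
   are distinct members of M.  In particular the L_i are distinct, because disjointness is
   required for any two different pairs, even if their first components agree. *)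
definition semi_matching :: "nat set set \<Rightarrow> (nat set \<times> nat set) set \<Rightarrow> bool" where
  "semi_matching H M \<longleftrightarrow>
     finite M \<and>
     (\<forall>(L, S)\<in>M. card L = 2 \<and> L \<subseteq> S \<and> S \<in> H) \<and>
     (\<forall>p\<in>M. \<forall>q\<in>M. p \<noteq> q \<longrightarrow> fst p \<inter> fst q = {}) \<and>
     (\<forall>p\<in>M. \<forall>q\<in>M. p \<noteq> q \<longrightarrow> \<not> fst p \<subseteq> snd q) \<and>
     (\<forall>S\<in>H. S \<subseteq> (\<Union>p\<in>M. snd p) \<longrightarrow> (\<exists>p\<in>M. fst p \<subseteq> S))"

(* card counts an infinite set as 0; the following facts rule this out for the two sets that
   are to be counted. *)

lemma blocker_subset: "blocker H \<subseteq> Pow (\<Union>H)"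
proof
  fix T assume T: "T \<in> blocker H"
  have "(T \<inter> \<Union>H) \<inter> S = T \<inter> S" if "S \<in> H" for S
    using that by blast
  with T have "transversal H (T \<inter> \<Union>H)"
    by (simp add: blocker_def transversal_def)
  with T have "T \<inter> \<Union>H = T"
    by (simp add: blocker_def)
  then show "T \<in> Pow (\<Union>H)" by blast
qed

lemma finite_blocker:
  assumes "clutter H"
  shows "finite (blocker H)"
proof (rule finite_subset[OF blocker_subset])
  show "finite (Pow (\<Union>H))"
    using assms by (simp add: clutter_def)
qed

lemma clutter_blocker:
  assumes "clutter H"
  shows "clutter (blocker H)"
proof -
  have "finite (\<Union>H)"
    using assms by (auto simp: clutter_def)
  then have "\<forall>T\<in>blocker H. finite T"
    using blocker_subset[of H] by (blast intro: finite_subset)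
  moreover have "\<forall>S\<in>blocker H. \<forall>T\<in>blocker H. S \<subseteq> T \<longrightarrow> S = T"
    unfolding blocker_def by blast
  ultimately show ?thesis
    using finite_blocker[OF assms] unfolding clutter_def by blast
qed

lemma finite_semi_matchings:
  assumes "clutter H"
  shows "finite {M. semi_matching H M}"
proof (rule finite_subset)
  show "{M. semi_matching H M} \<subseteq> Pow (Pow (\<Union>H) \<times> H)"
  proof clarify
    fix M L S assume "semi_matching H M" "(L, S) \<in> M"
    then have "L \<subseteq> S" "S \<in> H"
      unfolding semi_matching_def by auto
    then show "L \<in> Pow (\<Union>H) \<and> S \<in> H" by blast
  qed
  show "finite (Pow (Pow (\<Union>H) \<times> H))"
    using assms by (simp add: clutter_def)
qed

end

theory Submission imports Defs begin

text \<open>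
  The bound is proved by an injection from minimal transversals to semi-matchings, built by
  induction on the number of vertices.  The residual families met in the recursion need not be
  clutters, so the induction runs over all families with finite union.

  Fix a vertex \<open>v\<close>, and compare \<open>H\<close> with the family of its edges that avoid \<open>v\<close>.  Every minimal
  transversal \<open>T\<close> of \<open>H\<close> with \<open>T - {v}\<close> a minimal transversal of that smaller family is sent to
  the semi-matching which recursion assigns to \<open>T - {v}\<close>.  The other \<open>T\<close> miss \<open>v\<close>, and become
  redundant at some \<open>u \<in> T\<close> once the edges through \<open>v\<close> are gone.  So all edges that meet \<open>T\<close> in
  \<open>u\<close> alone contain \<open>L = {u, v}\<close>; let \<open>S\<close> be one of them.  Then \<open>T - {u}\<close> is a minimal transversal
  of the residual family of all \<open>E - S\<close> with \<open>L \<subseteq> E\<close> false (\<open>blocker_residual\<close>).  Lifting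
  the edges of a semi-matching of the residual family to edges of \<open>H\<close> and adding the pair
  \<open>(L, S)\<close> yields a semi-matching of \<open>H\<close> (\<open>semi_matching_insert_lift\<close>).

  The resulting semi-matching determines \<open>T\<close>: it has a pair \<open>(L, S)\<close> with \<open>v \<in> L\<close> exactly in the
  second case, there is then only one such pair, and it reveals \<open>u\<close> and \<open>S\<close>; what
  remains is the value of an injection for a smaller family, which reveals \<open>T - {v}\<close> or
  \<open>T - {u}\<close>.  For graphs this is
  the recursion showing that maximal independent sets are no more numerous than induced
  matchings.
\<close>

section \<open>Minimal transversals under removal of a vertex\<close>

definition deletion :: "nat set set \<Rightarrow> nat \<Rightarrow> nat set set" where
  "deletion H v = {E \<in> H. v \<notin> E}"

definition residual :: "nat set set \<Rightarrow> nat set \<Rightarrow> nat set \<Rightarrow> nat set set" where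
  "residual H L S = (\<lambda>E. E - S) ` {E \<in> H. \<not> L \<subseteq> E}"

text \<open>Removing \<open>t\<close> from a transversal \<open>T\<close> leaves an edge unhit exactly if that edge meets \<open>T\<close> in
  \<open>t\<close> alone.\<close>

lemma blocker_iff_private_edges:
  "T \<in> blocker H \<longleftrightarrow> transversal H T \<and> (\<forall>t\<in>T. \<exists>E\<in>H. T \<inter> E = {t})"
proof
  assume T: "T \<in> blocker H"
  then have tr: "transversal H T"
    by (simp add: blocker_def)
  have "\<exists>E\<in>H. T \<inter> E = {t}" if "t \<in> T" for t
  proof -
    have "\<not> transversal H (T - {t})"
      using T that unfolding blocker_def by blast
    then obtain E where "E \<in> H" "(T - {t}) \<inter> E = {}"
      unfolding transversal_def by blast
    then show ?thesis
      using tr unfolding transversal_def by blast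
  qed
  with tr show "transversal H T \<and> (\<forall>t\<in>T. \<exists>E\<in>H. T \<inter> E = {t})"
    by blast
next
  assume T: "transversal H T \<and> (\<forall>t\<in>T. \<exists>E\<in>H. T \<inter> E = {t})"
  have "T' = T" if T': "transversal H T'" "T' \<subseteq> T" for T'
  proof
    show "T \<subseteq> T'"
    proof
      fix t assume "t \<in> T"
      then obtain E where "E \<in> H" "T \<inter> E = {t}"
        using T by blast
      moreover from this T' obtain x where "x \<in> T'" "x \<in> E"
        unfolding transversal_def by blast
      ultimately show "t \<in> T'"
        using T'(2) by (metis IntI singletonD subsetD)
    qed
  qed (fact T'(2))
  with T show "T \<in> blocker H"
    unfolding blocker_def by blast
qed

lemma blocker_antichain:
  assumes "T \<in> blocker H" "T' \<in> blocker H" "T \<subseteq> T'"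
  shows "T = T'"
  using assms unfolding blocker_def by blast

lemma blocker_deletion:
  assumes "T \<in> blocker H" "v \<in> T"
  shows "T - {v} \<in> blocker (deletion H v)"
  unfolding blocker_iff_private_edges
proof
  show "transversal (deletion H v) (T - {v})"
    using assms unfolding blocker_iff_private_edges transversal_def deletion_def by blast
  show "\<forall>t\<in>T - {v}. \<exists>E\<in>deletion H v. (T - {v}) \<inter> E = {t}"
  proof
    fix t assume t: "t \<in> T - {v}"
    then obtain E where E: "E \<in> H" "T \<inter> E = {t}"
      using assms unfolding blocker_iff_private_edges by blast
    \<comment> \<open>\<open>v \<in> T\<close> is not the private vertex of \<open>E\<close>, hence \<open>E\<close> survives.\<close>
    moreover have "v \<notin> E"
    proof
      assume "v \<in> E"
      with assms(2) have "v \<in> T \<inter> E"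
        by blast
      with E(2) t show False
        by simp
    qed
    moreover from this E(2) have "(T - {v}) \<inter> E = {t}"
      by (simp add: Diff_Int_distrib2)
    ultimately show "\<exists>E\<in>deletion H v. (T - {v}) \<inter> E = {t}"
      unfolding deletion_def by blast
  qed
qed

text \<open>Since \<open>T\<close> still hits every edge avoiding \<open>v\<close>, its failure to be a minimal transversal of the
  deletion is due to some \<open>u \<in> T\<close> all of whose private edges pass through \<open>v\<close>.  Such an edge \<open>S\<close>
  misses \<open>T - {u}\<close>, so subtracting \<open>S\<close> from the other edges affects neither which of them
  \<open>T - {u}\<close> hits nor where.\<close>

lemma blocker_residual:
  assumes T: "T \<in> blocker H" and v: "v \<notin> T" and not_min: "T \<notin> blocker (deletion H v)"
  obtains u S where "u \<in> T" "S \<in> H" "u \<in> S" "v \<in> S"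
    "T - {u} \<in> blocker (residual H {u, v} S)"
proof -
  have tr: "E \<in> H \<Longrightarrow> T \<inter> E \<noteq> {}" for E
    using T unfolding blocker_iff_private_edges transversal_def by blast
  then have "transversal (deletion H v) T"
    unfolding transversal_def deletion_def by blast
  then obtain u where u: "u \<in> T" and no_private: "\<And>E. E \<in> H \<Longrightarrow> v \<notin> E \<Longrightarrow> T \<inter> E \<noteq> {u}"
    using not_min unfolding blocker_iff_private_edges deletion_def by blast
  then obtain S where S: "S \<in> H" "T \<inter> S = {u}"
    using T unfolding blocker_iff_private_edges by blast
  have "T - {u} \<in> blocker (residual H {u, v} S)"
    unfolding blocker_iff_private_edges
  proof
    have "(T - {u}) \<inter> (E - S) \<noteq> {}" if E: "E \<in> H" "\<not> {u, v} \<subseteq> E" for E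
    proof -
      have "(T - {u}) \<inter> E \<noteq> {}"
        using tr[OF E(1)] no_private[OF E(1)] E(2) by blast
      then show ?thesis
        using S(2) by blast
    qed
    then show "transversal (residual H {u, v} S) (T - {u})"
      unfolding transversal_def residual_def by blast
    show "\<forall>t\<in>T - {u}. \<exists>F\<in>residual H {u, v} S. (T - {u}) \<inter> F = {t}"
    proof
      fix t assume t: "t \<in> T - {u}"
      then obtain E where E: "E \<in> H" "T \<inter> E = {t}"
        using T unfolding blocker_iff_private_edges by blast
      have "u \<notin> E"
        using E(2) t u by (metis DiffD2 IntI singletonD singletonI)
      then have "\<not> {u, v} \<subseteq> E"
        by simp
      with E(1) have "E - S \<in> residual H {u, v} S"
        unfolding residual_def by blast
      moreover have "(T - {u}) \<inter> (E - S) = {t}"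
        using E(2) S(2) t by (auto simp: set_eq_iff)
      ultimately show "\<exists>F\<in>residual H {u, v} S. (T - {u}) \<inter> F = {t}"
        by blast
    qed
  qed
  moreover have "u \<in> S" "v \<in> S"
    using S(2) no_private[OF S(1)] by auto
  ultimately show ?thesis
    using that u S(1) by blast
qed

section \<open>Lifting semi-matchings\<close>

text \<open>The edges of a semi-matching of the deletion avoid \<open>v\<close>, so edges through \<open>v\<close> do not lie in
  their union and impose no covering condition.\<close>

lemma semi_matching_deletion:
  assumes "semi_matching (deletion H v) M"
  shows "semi_matching H M" "(L, S) \<in> M \<Longrightarrow> v \<notin> L"
proof -
  have edges: "v \<notin> snd p \<and> fst p \<subseteq> snd p \<and> snd p \<in> H" if "p \<in> M" for p
    using assms that unfolding semi_matching_def deletion_def by fastforce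
  then show "(L, S) \<in> M \<Longrightarrow> v \<notin> L"
    by fastforce
  have "\<exists>p\<in>M. fst p \<subseteq> E" if E: "E \<in> H" "E \<subseteq> (\<Union>p\<in>M. snd p)" for E
  proof -
    have "E \<in> deletion H v"
      using E edges unfolding deletion_def by blast
    then show ?thesis
      using assms E(2) unfolding semi_matching_def by blast
  qed
  moreover have "\<forall>(L, S)\<in>M. card L = 2 \<and> L \<subseteq> S \<and> S \<in> H"
    using assms unfolding semi_matching_def deletion_def by fastforce
  ultimately show "semi_matching H M"
    using assms unfolding semi_matching_def by simp
qed

lemma semi_matching_pair:
  assumes "semi_matching H M" "p \<in> M"
  shows "card (fst p) = 2" "fst p \<subseteq> snd p" "snd p \<in> H"
proof -
  have "\<forall>(L, S)\<in>M. card L = 2 \<and> L \<subseteq> S \<and> S \<in> H"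
    using assms(1) unfolding semi_matching_def by simp
  with assms(2) show "card (fst p) = 2" "fst p \<subseteq> snd p" "snd p \<in> H"
    by (simp_all add: case_prod_beta)
qed

lemma semi_matching_disjoint:
  assumes "semi_matching H M" "p \<in> M" "q \<in> M" "p \<noteq> q"
  shows "fst p \<inter> fst q = {}" "\<not> fst p \<subseteq> snd q"
  using assms unfolding semi_matching_def by blast+

text \<open>A member of the residual family may come from several edges, so lifting a semi-matching
  requires a choice \<open>c\<close> of one edge for each member.  Passing from \<open>E\<close> to \<open>E - S\<close> changes no
  inclusion between the \<open>L\<^sub>i\<close> and the edges, as the \<open>L\<^sub>i\<close> are disjoint from \<open>S\<close>.  For the
  covering condition, an edge either contains \<open>L\<close> or has a counterpart in the residual family.\<close>

lemma semi_matching_insert_lift: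
  assumes L: "card L = 2" "L \<subseteq> S" and S: "S \<in> H"
    and M: "semi_matching (residual H L S) M"
    and c: "\<And>F. F \<in> residual H L S \<Longrightarrow> c F \<in> H \<and> \<not> L \<subseteq> c F \<and> c F - S = F"
  shows "semi_matching H (insert (L, S) (map_prod id c ` M))"
proof -
  let ?N = "map_prod id c ` M"
  have lift: "card (fst p) = 2" "fst p \<subseteq> snd p" "snd p \<in> H" "\<not> L \<subseteq> snd p" "fst p \<inter> S = {}"
    if p: "p \<in> ?N" for p
  proof -
    obtain q where q: "p = map_prod id c q" "q \<in> M"
      using p by (rule imageE)
    note pair = semi_matching_pair[OF M q(2)]
    have c_q: "c (snd q) \<in> H" "\<not> L \<subseteq> c (snd q)" "c (snd q) - S = snd q"
      using c[OF pair(3)] by blast+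
    then have "fst q \<subseteq> c (snd q) - S"
      using pair(2) by simp
    then have "fst q \<subseteq> c (snd q)" "fst q \<inter> S = {}"
      by blast+
    with c_q pair(1) q(1)
    show "card (fst p) = 2" "fst p \<subseteq> snd p" "snd p \<in> H" "\<not> L \<subseteq> snd p" "fst p \<inter> S = {}"
      by simp_all
  qed
  have separate: "fst p \<inter> fst q = {}" "\<not> fst p \<subseteq> snd q"
    if pq: "p \<in> ?N" "q \<in> ?N" "p \<noteq> q" for p q
  proof -
    obtain p' where p': "p = map_prod id c p'" "p' \<in> M"
      using pq(1) by (rule imageE)
    obtain q' where q': "q = map_prod id c q'" "q' \<in> M"
      using pq(2) by (rule imageE)
    have "p' \<noteq> q'"
      using pq(3) p'(1) q'(1) by blast
    then have "fst p' \<inter> fst q' = {}" "\<not> fst p' \<subseteq> snd q'"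
      by (rule semi_matching_disjoint[OF M p'(2) q'(2)])+
    moreover have "c (snd q') - S = snd q'"
      using c[OF semi_matching_pair(3)[OF M q'(2)]] by blast
    moreover have "fst p' \<inter> S = {}"
      using lift(5)[OF pq(1)] p'(1) by simp
    ultimately have "fst p' \<inter> fst q' = {}" "\<not> fst p' \<subseteq> c (snd q')"
      by blast+
    with p' q' show "fst p \<inter> fst q = {}" "\<not> fst p \<subseteq> snd q"
      by simp_all
  qed
  have cover: "\<exists>p\<in>insert (L, S) ?N. fst p \<subseteq> E"
    if E: "E \<in> H" "E \<subseteq> (\<Union>p\<in>insert (L, S) ?N. snd p)" for E
  proof (cases "L \<subseteq> E")
    case False
    then have "E - S \<in> residual H L S"
      using E(1) unfolding residual_def by blast
    moreover have "E - S \<subseteq> (\<Union>p\<in>M. snd p)"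
    proof
      fix x assume x: "x \<in> E - S"
      then obtain p where "p \<in> M" "x \<in> c (snd p)"
        using E(2) by auto
      moreover from this x have "x \<in> snd p"
        using c[OF semi_matching_pair(3)[OF M]] by blast
      ultimately show "x \<in> (\<Union>p\<in>M. snd p)"
        by blast
    qed
    moreover have "\<forall>F\<in>residual H L S. F \<subseteq> (\<Union>p\<in>M. snd p) \<longrightarrow> (\<exists>p\<in>M. fst p \<subseteq> F)"
      using M unfolding semi_matching_def by simp
    ultimately obtain p where p: "p \<in> M" "fst p \<subseteq> E - S"
      by metis
    show ?thesis
    proof (rule bexI)
      show "fst (map_prod id c p) \<subseteq> E"
        using p(2) by (simp add: subset_iff)
      show "map_prod id c p \<in> insert (L, S) ?N"
        using p(1) by (intro insertI2 imageI)
    qed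
  qed simp
  have pairs: "\<forall>(L', S')\<in>insert (L, S) ?N. card L' = 2 \<and> L' \<subseteq> S' \<and> S' \<in> H"
  proof
    fix p assume "p \<in> insert (L, S) ?N"
    then show "case p of (L', S') \<Rightarrow> card L' = 2 \<and> L' \<subseteq> S' \<and> S' \<in> H"
      using L S lift(1-3)[of p] by (cases "p = (L, S)") (simp_all add: case_prod_beta)
  qed
  have apart: "fst p \<inter> fst q = {} \<and> \<not> fst p \<subseteq> snd q"
    if pq: "p \<in> insert (L, S) ?N" "q \<in> insert (L, S) ?N" "p \<noteq> q" for p q
  proof -
    consider "p \<in> ?N" "q \<in> ?N" | "p = (L, S)" "q \<in> ?N" | "p \<in> ?N" "q = (L, S)"
      using pq by (metis insert_iff)
    then show ?thesis
    proof cases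
      case 1
      with pq(3) show ?thesis
        using separate by blast
    next
      case 2
      then show ?thesis
        using lift(4,5)[OF 2(2)] L(2) by auto
    next
      case 3
      have "fst p \<noteq> {}"
        using lift(1)[OF 3(1)] by auto
      then show ?thesis
        using 3(2) lift(5)[OF 3(1)] L(2) by auto
    qed
  qed
  show ?thesis
    unfolding semi_matching_def
  proof (intro conjI)
    show "finite (insert (L, S) ?N)"
      using M unfolding semi_matching_def by simp
    show "\<forall>(L', S')\<in>insert (L, S) ?N. card L' = 2 \<and> L' \<subseteq> S' \<and> S' \<in> H"
      by (rule pairs)
  qed (intro ballI impI, rule apart[THEN conjunct1] apart[THEN conjunct2] cover, assumption+)+
qed

text \<open>Subtracting \<open>S\<close> from the edges undoes the lifting, and the added pair is recognised as the
  only one whose first component meets \<open>S\<close>.\<close>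

lemma insert_lift_inject:
  assumes M: "semi_matching (residual H L S) M" and M': "semi_matching (residual H L S) M'"
    and L: "card L = 2" "L \<subseteq> S"
    and c: "\<And>F. F \<in> residual H L S \<Longrightarrow> c F - S = F"
    and eq: "insert (L, S) (map_prod id c ` M) = insert (L, S) (map_prod id c ` M')"
  shows "M = M'"
proof -
  have recover: "N = map_prod id (\<lambda>E. E - S) ` (insert (L, S) (map_prod id c ` N) - {(L, S)})"
    if N: "semi_matching (residual H L S) N" for N
  proof -
    have "L \<noteq> {}"
      using L(1) by auto
    have "fst p \<inter> S = {}" if "p \<in> N" for p
      using semi_matching_pair[OF N that] unfolding residual_def by blast
    then have "(L, S) \<notin> map_prod id c ` N"
      using L(2) \<open>L \<noteq> {}\<close> by fastforce
    then have "insert (L, S) (map_prod id c ` N) - {(L, S)} = map_prod id c ` N"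
      by blast
    moreover have "map_prod id (\<lambda>E. E - S) (map_prod id c p) = p" if "p \<in> N" for p
      using c[OF semi_matching_pair(3)[OF N that]] by (cases p) simp
    ultimately show ?thesis
      by (simp add: image_image)
  qed
  show ?thesis
    using recover[OF M] recover[OF M'] eq by simp
qed

section \<open>Minimal transversals inject into semi-matchings\<close>

theorem blocker_injects_into_semi_matchings:
  assumes "finite (\<Union>H)"
  shows "\<exists>f. inj_on f (blocker H) \<and> f ` blocker H \<subseteq> {M. semi_matching H M}"
  using assms
proof (induction "card (\<Union>H)" arbitrary: H rule: less_induct)
  case less
  show ?case
  proof (cases "\<Union>H = {}")
    case True
    \<comment> \<open>Here \<open>H\<close> may contain the empty edge; then it has neither transversals nor semi-matchings.\<close>
    have "blocker H \<subseteq> {{}}"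
      using blocker_subset[of H] True by simp
    moreover have "semi_matching H {}" if "{} \<in> blocker H"
      using that unfolding blocker_def transversal_def semi_matching_def by simp
    ultimately have "inj_on (\<lambda>_. {}) (blocker H)"
      "(\<lambda>_. {}) ` blocker H \<subseteq> {M. semi_matching H M}"
      by (auto intro!: inj_onI)
    then show ?thesis
      by blast
  next
    case False
    then obtain v where v: "v \<in> \<Union>H"
      by blast
    have smaller: "finite (\<Union>H') \<and> card (\<Union>H') < card (\<Union>H)" if "\<Union>H' \<subseteq> \<Union>H - {v}" for H'
    proof -
      have "\<Union>H' \<subset> \<Union>H"
        using that v by blast
      then show ?thesis
        using psubset_card_mono[OF less.prems] finite_subset[OF _ less.prems] by simp
    qed
    have "\<Union>(deletion H v) \<subseteq> \<Union>H - {v}"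
      unfolding deletion_def by blast
    then obtain g where g: "inj_on g (blocker (deletion H v))"
      "\<And>T. T \<in> blocker (deletion H v) \<Longrightarrow> semi_matching (deletion H v) (g T)"
      using less.hyps[of "deletion H v"] smaller[of "deletion H v"]
      unfolding image_subset_iff mem_Collect_eq by metis
    have "\<forall>u S. \<exists>h. v \<in> S \<longrightarrow> inj_on h (blocker (residual H {u, v} S)) \<and>
        h ` blocker (residual H {u, v} S) \<subseteq> {M. semi_matching (residual H {u, v} S) M}"
    proof (intro allI)
      fix u S
      have "\<Union>(residual H {u, v} S) \<subseteq> \<Union>H - {v}" if "v \<in> S"
        using that unfolding residual_def by blast
      then show "\<exists>h. v \<in> S \<longrightarrow> inj_on h (blocker (residual H {u, v} S)) \<and>
          h ` blocker (residual H {u, v} S) \<subseteq> {M. semi_matching (residual H {u, v} S) M}"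
        using less.hyps smaller by simp
    qed
    then obtain h where "\<forall>u S. v \<in> S \<longrightarrow> inj_on (h u S) (blocker (residual H {u, v} S)) \<and>
        h u S ` blocker (residual H {u, v} S) \<subseteq> {M. semi_matching (residual H {u, v} S) M}"
      by metis
    then have h: "\<And>u S. v \<in> S \<Longrightarrow> inj_on (h u S) (blocker (residual H {u, v} S))"
      "\<And>u S T. v \<in> S \<Longrightarrow> T \<in> blocker (residual H {u, v} S) \<Longrightarrow>
        semi_matching (residual H {u, v} S) (h u S T)"
      by (simp_all add: image_subset_iff)
    have "\<forall>u S F. \<exists>E. F \<in> residual H {u, v} S \<longrightarrow> E \<in> H \<and> \<not> {u, v} \<subseteq> E \<and> E - S = F"
      unfolding residual_def by blast
    then obtain c where c: "\<And>u S F. F \<in> residual H {u, v} S \<Longrightarrow>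
        c u S F \<in> H \<and> \<not> {u, v} \<subseteq> c u S F \<and> c u S F - S = F"
      by metis
    define old where "old T \<longleftrightarrow> T - {v} \<in> blocker (deletion H v)" for T
    have "\<exists>u S. u \<in> T \<and> v \<notin> T \<and> S \<in> H \<and> u \<in> S \<and> v \<in> S \<and> T - {u} \<in> blocker (residual H {u, v} S)"
      if T: "T \<in> blocker H" "\<not> old T" for T
    proof -
      have "v \<notin> T"
        using T blocker_deletion unfolding old_def by blast
      moreover from this T(2) have "T \<notin> blocker (deletion H v)"
        unfolding old_def by simp
      ultimately show ?thesis
        using blocker_residual[OF T(1)] by metis
    qed
    then obtain u S where uS: "\<And>T. T \<in> blocker H \<Longrightarrow> \<not> old T \<Longrightarrow> u T \<in> T \<and> v \<notin> T \<and> S T \<in> H \<and>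
        u T \<in> S T \<and> v \<in> S T \<and> T - {u T} \<in> blocker (residual H {u T, v} (S T))"
      by metis
    define M where "M T = h (u T) (S T) (T - {u T})" for T
    define f where "f T = (if old T then g (T - {v})
      else insert ({u T, v}, S T) (map_prod id (c (u T) (S T)) ` M T))" for T
    have M: "semi_matching (residual H {u T, v} (S T)) (M T)" if "T \<in> blocker H" "\<not> old T" for T
      unfolding M_def using uS[OF that] h(2) by blast
    have L: "card {u T, v} = 2" "{u T, v} \<subseteq> S T" if "T \<in> blocker H" "\<not> old T" for T
      using uS[OF that] by (auto simp: card_2_iff)
    have f_old: "semi_matching (deletion H v) (f T)" if "old T" for T
      using that g(2) unfolding f_def old_def by simp
    have f_new: "semi_matching H (f T)" if "T \<in> blocker H" "\<not> old T" for T
      using semi_matching_insert_lift[OF L[OF that] _ M[OF that], of "c (u T) (S T)"]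
        uS[OF that] c that unfolding f_def by simp
    have new_pair: "({u T, v}, S T) \<in> f T" if "\<not> old T" for T
      using that unfolding f_def by simp
    have same_kind: "old T" if "T \<in> blocker H" "f T = f T'" "old T'" for T T'
    proof (rule ccontr)
      assume "\<not> old T"
      then show False
        using new_pair[of T] semi_matching_deletion(2)[OF f_old[OF that(3)]] that(2) by force
    qed
    have "inj_on f (blocker H)"
    proof (rule inj_onI)
      fix T T' assume T: "T \<in> blocker H" and T': "T' \<in> blocker H" and eq: "f T = f T'"
      show "T = T'"
      proof (cases "old T")
        case True
        then have "old T'"
          by (rule same_kind[OF T' eq[symmetric]])
        with True eq have "T - {v} = T' - {v}"
          using inj_onD[OF g(1)] unfolding f_def old_def by simp
        \<comment> \<open>The two sets differ at most in \<open>v\<close>, so one contains the other.\<close>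
        then have "T \<subseteq> T' \<or> T' \<subseteq> T"
          by blast
        then show ?thesis
          using blocker_antichain[OF T T'] blocker_antichain[OF T' T] by auto
      next
        case False
        then have False': "\<not> old T'"
          using same_kind[OF T] eq by blast
        \<comment> \<open>Both first components contain \<open>v\<close>, while those of distinct pairs are disjoint.\<close>
        have "({u T, v}, S T) = ({u T', v}, S T')"
        proof (rule ccontr)
          assume "({u T, v}, S T) \<noteq> ({u T', v}, S T')"
          moreover have "({u T', v}, S T') \<in> f T"
            using new_pair[OF False'] eq by simp
          ultimately have "fst ({u T, v}, S T) \<inter> fst ({u T', v}, S T') = {}"
            using semi_matching_disjoint(1)[OF f_new[OF T False] new_pair[OF False]] by blast
          then show False
            by simp
        qed
        then have uS_eq: "u T' = u T" "S T' = S T"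
          by (auto simp: doubleton_eq_iff)
        have "M T = M T'"
        proof (rule insert_lift_inject[OF M[OF T False] _ L[OF T False]])
          show "semi_matching (residual H {u T, v} (S T)) (M T')"
            using M[OF T' False'] uS_eq by simp
          show "c (u T) (S T) F - S T = F" if "F \<in> residual H {u T, v} (S T)" for F
            using c[OF that] by blast
          show "insert ({u T, v}, S T) (map_prod id (c (u T) (S T)) ` M T) =
              insert ({u T, v}, S T) (map_prod id (c (u T) (S T)) ` M T')"
            using eq False False' uS_eq unfolding f_def by simp
        qed
        then have "T - {u T} = T' - {u T}"
          using inj_onD[OF h(1)[of "S T" "u T"]] uS[OF T False] uS[OF T' False'] uS_eq
          unfolding M_def by simp
        then show ?thesis
          using uS[OF T False] uS[OF T' False'] uS_eq by (metis insert_Diff)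
      qed
    qed
    moreover have "semi_matching H (f T)" if "T \<in> blocker H" for T
      using f_new[OF that] semi_matching_deletion(1)[OF f_old, of T] by (cases "old T") simp_all
    ultimately show ?thesis
      by (intro exI[of _ f] conjI image_subsetI CollectI)
  qed
qed

theorem theorem3p2:
  fixes H :: "nat set set"
  assumes "clutter H"
  shows "card (blocker H) \<le> card {M. semi_matching H M}"
proof -
  have "finite (\<Union>H)"
    using assms unfolding clutter_def by blast
  then obtain f where "inj_on f (blocker H)" "f ` blocker H \<subseteq> {M. semi_matching H M}"
    using blocker_injects_into_semi_matchings by blast
  then show ?thesis
    using finite_semi_matchings[OF assms] by (rule card_inj_on_le)
qed

end
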